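(* Let $\beta>1$ and let $\eta_1$ be the first hitting time of $\overline{\rho}$ by the walk $W$ on the random tree $\overline{\mathcal{T}}$ started from $\rho$. If $\beta^2\mu\ge1$ or $\mathbf{E}[\xi^3]=\infty$ then $$\mathbb{E}[\eta_1^2]\ge\mathbf{E}\big[E^{\overline{\mathcal{T}}}[\eta_1]^2\big]=\infty.$$
   Context: Let $\xi$ be an offspring random variable with $\mathbf{P}(\xi=k)=p_k$, mean $\mu\in(0,1)$ and variance $\sigma^2<\infty$, such that $p_k>0$ for some $k\ge2$; let $f$ be its generating function. Let $\xi^*$ have the size-biased law $\mathbf{P}(\xi^*=k)=kp_k/\mu$. The random tree $\overline{\mathcal{T}}$ is built as follows: take a vertex $\rho$ with a unique ancestor (parent) $\overline{\rho}$; attach $\xi^*-1$ children to $\rho$; to each such child attach an independent $f$-Galton-Watson tree rooted at that child. Let $c(x)$ be the set of children of $x$ and $\overleftarrow{x}$ its parent. Given $\overline{\mathcal{T}}$, $(W_n)_{n\ge0}$ is the Markov chain absorbed at $\overline{\rho}$ with transition probabilities: from $\rho$, to $\overline{\rho}$ with probability $\frac{\beta+1}{\beta(|c(\rho)|+1)+1}$ and to each $y\in c(\rho)$ with probability $\frac{\beta}{\beta(|c(\rho)|+1)+1}$; from $x\notin\{\rho,\overline{\rho}\}$, to each $y\in c(x)$ with probability $\frac{\beta}{|c(x)|\beta+1}$ and to $\overleftarrow{x}$ with probability $\frac{1}{|c(x)|\beta+1}$. $E^{\overline{\mathcal{T}}}$ is expectation over $W$ (started from $\rho$) for fixed $\overline{\mathcal{T}}$,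 $\mathbf{E}$ is expectation over $\overline{\mathcal{T}}$ (and $\xi$), and $\mathbb{E}[\cdot]=\mathbf{E}[E^{\overline{\mathcal{T}}}[\cdot]]$. *)

theory Defs
  imports "HOL-Probability.Probability"
begin

definition offspring_mean :: "nat pmf \<Rightarrow> real" where
  "offspring_mean p = measure_pmf.expectation p real"

text \<open>
  The law of \<open>\<xi>\<^sup>*\<close>. The prescribed weights sum to 1 whenever the mean is finite and
  positive, see \<open>pmf_size_biased\<close>.
\<close>

definition size_biased :: "nat pmf \<Rightarrow> nat pmf" where
  "size_biased p = embed_pmf (\<lambda>k. real k * pmf p k / offspring_mean p)"

lemma pmf_size_biased:
  assumes "integrable (measure_pmf p) real" and "offspring_mean p > 0"
  shows "pmf (size_biased p) k = real k * pmf p k / offspring_mean p"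
  unfolding size_biased_def
proof (rule pmf_embed_pmf)
  show "0 \<le> real k * pmf p k / offspring_mean p" for k
    using assms(2) by simp
  have "(\<integral>\<^sup>+k. ennreal (real k * pmf p k / offspring_mean p) \<partial>count_space UNIV)
      = (\<integral>\<^sup>+k. ennreal (pmf p k) * ennreal (real k / offspring_mean p) \<partial>count_space UNIV)"
    by (intro nn_integral_cong) (simp add: ennreal_mult'[symmetric] mult.commute)
  also have "\<dots> = (\<integral>\<^sup>+k. ennreal (real k / offspring_mean p) \<partial>measure_pmf p)"
    by (simp add: nn_integral_measure_pmf)
  also have "\<dots> = ennreal (\<integral>k. real k / offspring_mean p \<partial>measure_pmf p)"
    using assms by (intro nn_integral_eq_integral) auto
  also have "\<dots> = 1"
    using assms by (simp add: offspring_mean_def)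
  finally show "(\<integral>\<^sup>+k. ennreal (real k * pmf p k / offspring_mean p) \<partial>count_space UNIV) = 1" .
qed

text \<open>
  Plane trees are prefix-closed sets of words over \<open>nat\<close> (Ulam--Harris labels): the root is the
  empty word and the children of \<open>u\<close> are words \<open>u @ [i]\<close>. The tree determined by a family of
  offspring numbers \<open>N\<close> gives the vertex \<open>u\<close> exactly \<open>N u\<close> children.
\<close>

type_synonym tree = "nat list set"

inductive_set offspring_tree :: "(nat list \<Rightarrow> nat) \<Rightarrow> tree" for N where
  root: "[] \<in> offspring_tree N"
| child: "u \<in> offspring_tree N \<Longrightarrow> i < N u \<Longrightarrow> u @ [i] \<in> offspring_tree N"

text \<open>
  Under this measure the offspring numbers are i.i.d. with law \<open>p\<close>, so \<open>offspring_tree\<close> is a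
  Galton--Watson tree.
\<close>

definition gw_space :: "nat pmf \<Rightarrow> (nat list \<Rightarrow> nat) measure" where
  "gw_space p = PiM UNIV (\<lambda>_. measure_pmf p)"

text \<open>
  The part of the tree \<open>\<T>\<close>-bar that descends from \<open>\<rho>\<close> (the empty word); the extra vertex \<open>\<rho>\<close>-bar
  is added in the type \<open>vertex\<close> below. In a sample \<open>(k, N)\<close>, \<open>k\<close> is the value of \<open>\<xi>\<^sup>*\<close>, and the
  offspring family \<open>N i\<close> produces the tree attached at the \<open>i\<close>-th child of \<open>\<rho>\<close>.
\<close>

type_synonym sample = "nat \<times> (nat \<Rightarrow> nat list \<Rightarrow> nat)"

definition bar_tree :: "sample \<Rightarrow> tree" where
  "bar_tree = (\<lambda>(k, N). insert [] {i # u |i u. i < k - 1 \<and> u \<in> offspring_tree (N i)})"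

definition bar_tree_space :: "nat pmf \<Rightarrow> sample measure" where
  "bar_tree_space p = measure_pmf (size_biased p) \<Otimes>\<^sub>M PiM UNIV (\<lambda>_. gw_space p)"

definition tree_expectation :: "nat pmf \<Rightarrow> (tree \<Rightarrow> ennreal) \<Rightarrow> ennreal" where
  "tree_expectation p F = (\<integral>\<^sup>+s. F (bar_tree s) \<partial>bar_tree_space p)"

definition children :: "tree \<Rightarrow> nat list \<Rightarrow> nat list set" where
  "children T x = {x @ [i] |i. x @ [i] \<in> T}"

lemma bar_tree_children:
  "children (bar_tree (k, N)) [] = (\<lambda>i. [i]) ` {..<k - 1}"
  "i < k - 1 \<Longrightarrow> u \<in> offspring_tree (N i) \<Longrightarrow>
    children (bar_tree (k, N)) (i # u) = (\<lambda>j. i # u @ [j]) ` {..<N i u}"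
  by (auto simp: children_def bar_tree_def intro: offspring_tree.intros
      elim: offspring_tree.cases)

lemma finite_children_bar_tree: "finite (children (bar_tree s) x)"
proof -
  obtain k N where s: "s = (k, N)" by (cases s)
  show ?thesis
  proof (cases x)
    case Nil
    then show ?thesis by (simp add: s bar_tree_children)
  next
    case (Cons i u)
    have "children (bar_tree s) x \<subseteq> (\<lambda>j. x @ [j]) ` {..<N i u}"
      by (auto simp: s Cons children_def bar_tree_def elim: offspring_tree.cases)
    then show ?thesis by (rule finite_subset) simp
  qed
qed

text \<open>\<open>None\<close> is the ancestor \<open>\<rho>\<close>-bar of the root, and \<open>Some []\<close> is the root \<open>\<rho>\<close>.\<close>

type_synonym vertex = "nat list option"

definition trans_prob :: "real \<Rightarrow> tree \<Rightarrow> vertex \<Rightarrow> vertex \<Rightarrow> real" where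
  "trans_prob \<beta> T v w =
    (case v of
       None \<Rightarrow> (if w = None then 1 else 0)
     | Some x \<Rightarrow>
         let d = real (card (children T x)) in
         if x = [] then
           (case w of
              None \<Rightarrow> (\<beta> + 1) / (\<beta> * (d + 1) + 1)
            | Some y \<Rightarrow> (if y \<in> children T x then \<beta> / (\<beta> * (d + 1) + 1) else 0))
         else
           (case w of
              None \<Rightarrow> 0
            | Some y \<Rightarrow>
                if y \<in> children T x then \<beta> / (d * \<beta> + 1)
                else if y = butlast x then 1 / (d * \<beta> + 1)
                else 0))"

definition step :: "real \<Rightarrow> tree \<Rightarrow> vertex \<Rightarrow> vertex pmf" where
  "step \<beta> T v = embed_pmf (trans_prob \<beta> T v)"

lemma pmf_step:
  assumes "\<beta> > 0" and fin: "\<And>x. finite (children T x)"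
  shows "pmf (step \<beta> T v) w = trans_prob \<beta> T v w"
  unfolding step_def
proof (rule pmf_embed_pmf)
  show nonneg: "0 \<le> trans_prob \<beta> T v w" for w
    using assms(1) by (auto simp: trans_prob_def Let_def split: option.split)
  have "\<exists>A. finite A \<and> (\<forall>w. w \<notin> A \<longrightarrow> trans_prob \<beta> T v w = 0) \<and>
    (\<Sum>w\<in>A. trans_prob \<beta> T v w) = 1"
  proof (cases v)
    case None
    then show ?thesis by (intro exI[of _ "{None}"]) (auto simp: trans_prob_def)
  next
    case (Some x)
    let ?C = "children T x"
    let ?d = "real (card ?C)"
    let ?q = "if x = [] then None else Some (butlast x)"
    have "butlast x \<notin> ?C"
    proof
      assume "butlast x \<in> ?C"
      then obtain i where "butlast x = x @ [i]" by (auto simp: children_def)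
      then have "length (butlast x) = length (x @ [i])" by simp
      then show False by simp
    qed
    then have q: "?q \<notin> Some ` ?C" by auto
    have pos: "\<beta> * (?d + 1) + 1 > 0" "?d * \<beta> + 1 > 0"
      using assms(1) by (auto intro!: add_nonneg_pos)
    have "(\<Sum>w\<in>insert ?q (Some ` ?C). trans_prob \<beta> T v w)
        = trans_prob \<beta> T v ?q + (\<Sum>y\<in>?C. trans_prob \<beta> T v (Some y))"
      using q fin[of x] by (subst sum.insert) (auto simp: sum.reindex)
    also have "\<dots> = 1"
      using pos \<open>butlast x \<notin> ?C\<close>
      by (cases "x = []") (auto simp: trans_prob_def Some Let_def divide_simps, simp_all add: algebra_simps)
    finally show ?thesis
      using fin[of x]
      by (intro exI[of _ "insert ?q (Some ` ?C)"])
         (auto simp: trans_prob_def Some Let_def split: option.split)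
  qed
  then obtain A where A: "finite A" "\<And>w. w \<notin> A \<Longrightarrow> trans_prob \<beta> T v w = 0"
    "(\<Sum>w\<in>A. trans_prob \<beta> T v w) = 1" by blast
  have "(\<integral>\<^sup>+w. ennreal (trans_prob \<beta> T v w) \<partial>count_space UNIV) = (\<Sum>w\<in>A. ennreal (trans_prob \<beta> T v w))"
    using A by (intro nn_integral_count_space') auto
  also have "\<dots> = 1" using A(3) nonneg by (simp add: sum_ennreal)
  finally show "(\<integral>\<^sup>+w. ennreal (trans_prob \<beta> T v w) \<partial>count_space UNIV) = 1" .
qed

text \<open>
  The chain is realised from independent instructions \<open>\<omega> (n, v)\<close>, distributed as
  \<open>step \<beta> T v\<close>, telling the walk where to go if it is at \<open>v\<close> at time \<open>n\<close>. That the path then has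
  the law of the Markov chain started from \<open>\<rho>\<close> is \<open>walk_law_cylinder\<close>.
\<close>

definition instructions :: "real \<Rightarrow> tree \<Rightarrow> (nat \<times> vertex \<Rightarrow> vertex) measure" where
  "instructions \<beta> T = PiM UNIV (\<lambda>(n, v). measure_pmf (step \<beta> T v))"

primrec follow :: "(nat \<times> vertex \<Rightarrow> vertex) \<Rightarrow> nat \<Rightarrow> vertex" where
  "follow \<omega> 0 = Some []"
| "follow \<omega> (Suc n) = \<omega> (n, follow \<omega> n)"

definition walk_law :: "real \<Rightarrow> tree \<Rightarrow> (nat \<Rightarrow> vertex) measure" where
  "walk_law \<beta> T = distr (instructions \<beta> T) (PiM UNIV (\<lambda>_. count_space UNIV)) follow"

lemma measurable_follow:
  "follow \<in> measurable (instructions \<beta> T) (PiM UNIV (\<lambda>_. count_space UNIV))"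
proof (rule measurable_PiM_single')
  have proj: "(\<lambda>\<omega>. \<omega> nv) \<in> measurable (instructions \<beta> T) (count_space UNIV)" for nv
  proof -
    have "(\<lambda>\<omega>. \<omega> nv) \<in> measurable (instructions \<beta> T)
        (case nv of (n, v) \<Rightarrow> measure_pmf (step \<beta> T v))"
      unfolding instructions_def by (rule measurable_component_singleton) simp
    then show ?thesis by (cases nv) simp
  qed
  show "(\<lambda>\<omega>. follow \<omega> n) \<in> measurable (instructions \<beta> T) (count_space UNIV)" for n
  proof (induction n)
    case (Suc n)
    have "(\<lambda>\<omega>. (\<lambda>v \<omega>. \<omega> (n, v)) (follow \<omega> n) \<omega>)
        \<in> measurable (instructions \<beta> T) (count_space UNIV)"
      by (rule measurable_compose_countable[OF proj Suc])
    then show ?case by simp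
  qed simp
qed (auto simp: space_PiM)

lemma walk_law_cylinder:
  "emeasure (walk_law \<beta> T) {w. \<forall>i\<le>n. w i = x i} =
    (if x 0 = Some [] then \<Prod>i<n. ennreal (pmf (step \<beta> T (x i)) (x (Suc i))) else 0)"
proof -
  let ?M = "\<lambda>(n::nat, v). measure_pmf (step \<beta> T v)"
  have prob: "prob_space (?M j)" for j
    by (cases j) (simp add: measure_pmf.prob_space_axioms)
  interpret product_prob_space ?M UNIV
    by (intro product_prob_space.intro product_prob_space_axioms.intro
        product_sigma_finite.intro prob_space_imp_sigma_finite prob)
  have space: "space (instructions \<beta> T) = UNIV"
    by (auto simp: instructions_def space_PiM split: prod.split)
  have eq: "(\<forall>i\<le>n. follow \<omega> i = x i) \<longleftrightarrow>
      x 0 = Some [] \<and> (\<forall>i<n. \<omega> (i, x i) = x (Suc i))" for \<omega>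
  proof (induction n)
    case (Suc n)
    then show ?case by (auto simp: le_Suc_eq less_Suc_eq)
  qed auto
  have meas: "{w. \<forall>i\<le>n. w i = x i} \<in> sets (PiM UNIV (\<lambda>_. count_space UNIV))"
  proof -
    have "{w \<in> space (PiM UNIV (\<lambda>_. count_space UNIV)). \<forall>i\<in>{..n}. w i = x i}
        \<in> sets (PiM UNIV (\<lambda>_. count_space UNIV))"
      by measurable
    then show ?thesis by (simp add: space_PiM Ball_def)
  qed
  have "emeasure (walk_law \<beta> T) {w. \<forall>i\<le>n. w i = x i}
      = emeasure (instructions \<beta> T) {\<omega>. x 0 = Some [] \<and> (\<forall>i<n. \<omega> (i, x i) = x (Suc i))}"
    unfolding walk_law_def
    by (subst emeasure_distr[OF measurable_follow meas])
       (auto simp: space eq vimage_def)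
  also have "\<dots> = (if x 0 = Some [] then \<Prod>i<n. ennreal (pmf (step \<beta> T (x i)) (x (Suc i))) else 0)"
  proof (cases "x 0 = Some []")
    case True
    let ?J = "(\<lambda>i. (i, x i)) ` {..<n}"
    have inj: "inj_on (\<lambda>i. (i, x i)) {..<n}" by (auto simp: inj_on_def)
    have "emeasure (PiM UNIV ?M) {\<omega>\<in>space (PiM UNIV ?M). \<forall>j\<in>?J. \<omega> j \<in> {x (Suc (fst j))}}
        = (\<Prod>j\<in>?J. emeasure (?M j) {x (Suc (fst j))})"
      by (rule emeasure_PiM_Collect) auto
    also have "\<dots> = (\<Prod>i<n. ennreal (pmf (step \<beta> T (x i)) (x (Suc i))))"
      by (simp add: prod.reindex[OF inj] emeasure_pmf_single)
    finally show ?thesis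
      using True space by (simp add: instructions_def lessThan_def)
  qed simp
  finally show ?thesis .
qed

definition walk_expectation :: "real \<Rightarrow> tree \<Rightarrow> ((nat \<Rightarrow> vertex) \<Rightarrow> ennreal) \<Rightarrow> ennreal" where
  "walk_expectation \<beta> T F = (\<integral>\<^sup>+w. F w \<partial>walk_law \<beta> T)"

text \<open>The first hitting time of \<open>\<rho>\<close>-bar; it is \<open>\<infinity>\<close> on paths that never reach \<open>\<rho>\<close>-bar.\<close>

definition hit_time :: "(nat \<Rightarrow> vertex) \<Rightarrow> ennreal" where
  "hit_time w = (INF n\<in>{n. w n = None}. of_nat n)"

definition annealed_expectation :: "nat pmf \<Rightarrow> real \<Rightarrow> ((nat \<Rightarrow> vertex) \<Rightarrow> ennreal) \<Rightarrow> ennreal" where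
  "annealed_expectation p \<beta> F = tree_expectation p (\<lambda>T. walk_expectation \<beta> T F)"

end

theory Submission
  imports Defs
begin

text \<open>
  The walk moves on a tree with conductances \<open>\<beta> ^ length x\<close> on the edge above \<open>x \<noteq> \<rho>\<close> and
  \<open>\<beta> + 1\<close> on the edge from \<open>\<rho>\<close> to the absorbing vertex. Fix the tree and suppose that the mean
  hitting time is finite. Then the walk is eventually absorbed, so every edge below \<open>\<rho>\<close> is crossed
  downwards as often as upwards, and the absorbing edge is crossed exactly once
  (\<open>green_balance\<close>). Propagating this balance from \<open>\<rho>\<close> down a branch shows that the mean number
  of moves from \<open>x\<close> to its parent is the conductance of the edge above \<open>x\<close>, divided by \<open>\<beta> + 1\<close>
  (\<open>green_lower_bound\<close> proves the inequality that matters). Since \<open>x\<close> is visited at least that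
  often, and the hitting time counts all visits, the mean hitting time is at least
  \<open>\<Sum>x. \<beta> ^ length x / (\<beta> + 1)\<close>, summed over the tree
  (\<open>walk_expectation_hit_time_ge_tree_sum\<close>). For an infinite mean hitting time the
  bound is trivial, which also takes care of trees on which the walk may escape.

  The square of this sum has infinite mean over the tree in both cases.
  If \<open>\<beta>\<^sup>2 \<mu> \<ge> 1\<close>, the square of the sum dominates the sum of the squares
  \<open>\<beta> ^ (2 * length x)\<close>. The subtree of the first child of \<open>\<rho>\<close>, present with positive probability,
  has on average \<open>\<mu> ^ n\<close> vertices in generation \<open>n\<close>, and \<open>\<Sum>n. (\<beta>\<^sup>2 \<mu>) ^ n\<close> diverges
  (\<open>mean_hit_time_square_infinite_if_growth\<close>).
  If \<open>\<xi>\<close> has infinite third moment, the children of \<open>\<rho>\<close> suffice: there are \<open>\<xi>\<^sup>* - 1\<close> of them, and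
  size-biasing turns the infinite third moment of \<open>\<xi>\<close> into an infinite second moment of \<open>\<xi>\<^sup>*\<close>
  (\<open>mean_hit_time_square_infinite_if_third_moment\<close>).

  The remaining inequality between the two expectations is the Cauchy--Schwarz inequality on each
  tree.
\<close>

section \<open>The law of the position and the mean hitting time\<close>

primrec position :: "real \<Rightarrow> tree \<Rightarrow> nat \<Rightarrow> vertex pmf" where
  "position \<beta> T 0 = return_pmf (Some [])"
| "position \<beta> T (Suc n) = bind_pmf (position \<beta> T n) (step \<beta> T)"

lemma sets_walk_law [measurable_cong]:
  "sets (walk_law \<beta> T) = sets (PiM UNIV (\<lambda>_. count_space UNIV))"
  by (simp add: walk_law_def)

lemma space_walk_law [simp]: "space (walk_law \<beta> T) = UNIV"
  by (simp add: walk_law_def space_PiM)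

lemma measurable_walk_position [measurable]:
  "(\<lambda>w. w n) \<in> measurable (walk_law \<beta> T) (count_space UNIV)"
  by (simp add: measurable_cong_sets[OF sets_walk_law refl])

lemma prob_space_walk_law: "prob_space (walk_law \<beta> T)"
proof -
  have "prob_space (instructions \<beta> T)"
    unfolding instructions_def
    by (intro prob_space_PiM) (auto simp: measure_pmf.prob_space_axioms split: prod.split)
  then show ?thesis
    unfolding walk_law_def by (rule prob_space.prob_space_distr[OF _ measurable_follow])
qed

lemma sets_walk_Collect:
  "Measurable.pred (PiM UNIV (\<lambda>_. count_space UNIV)) P \<Longrightarrow> {w. P w} \<in> sets (walk_law \<beta> T)"
  by (simp add: sets_walk_law pred_def space_PiM)

text \<open>
  The Markov property at time \<open>n\<close>, obtained by splitting both events according to the path up to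
  time \<open>n\<close>: each piece is a cylinder, and the cylinder of length \<open>Suc n\<close> has one more factor.
\<close>

lemma walk_two_positions:
  "emeasure (walk_law \<beta> T) {w. w n = u \<and> w (Suc n) = v} =
    emeasure (walk_law \<beta> T) {w. w n = u} * ennreal (pmf (step \<beta> T u) v)"
proof -
  let ?W = "walk_law \<beta> T" and ?L = "{xs :: vertex list. length xs = n}"
  \<comment> \<open>\<open>x xs\<close> is the path that starts with the \<open>n\<close> vertices \<open>xs\<close> and continues with \<open>u\<close>, \<open>v\<close>;
    on \<open>{..n}\<close> it ends in \<open>u\<close>, so the same path serves for both cylinders.\<close>
  define x where "x xs i = (if i < n then xs ! i else if i = n then u else v)"
    for xs :: "vertex list" and i
  have x_simps: "x xs n = u" "x xs (Suc n) = v" for xs by (auto simp: x_def)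
  have cyl: "{w. \<forall>i\<le>m. w i = x xs i} \<in> sets ?W" for m xs
    by (rule sets_walk_Collect) (unfold atMost_iff[symmetric] Ball_def[symmetric], measurable)
  have pref: "xs = map w [0..<n]" if "length xs = n" "\<forall>i\<le>m. w i = x xs i" "n \<le> m" for m xs w
    using that by (intro nth_equalityI) (auto simp: x_def)
  have disj: "disjoint_family_on (\<lambda>xs. {w. \<forall>i\<le>m. w i = x xs i}) ?L" if "n \<le> m" for m
    unfolding disjoint_family_on_def
  proof (intro ballI impI equals0I)
    fix xs ys w
    assume "xs \<in> ?L" "ys \<in> ?L" "xs \<noteq> ys"
      and "w \<in> {w. \<forall>i\<le>m. w i = x xs i} \<inter> {w. \<forall>i\<le>m. w i = x ys i}"
    then show False using pref[of xs m w] pref[of ys m w] that by auto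
  qed
  have ext: "w i = x (map w [0..<n]) i" if "w n = u" "w (Suc n) = v \<or> i \<le> n" "i \<le> Suc n" for w i
    using that by (auto simp: x_def le_Suc_eq)
  have "{w. w n = u \<and> w (Suc n) = v} = (\<Union>xs\<in>?L. {w. \<forall>i\<le>Suc n. w i = x xs i})"
  proof (intro equalityI subsetI)
    fix w assume "w \<in> {w. w n = u \<and> w (Suc n) = v}"
    then show "w \<in> (\<Union>xs\<in>?L. {w. \<forall>i\<le>Suc n. w i = x xs i})"
      using ext[of w] by (intro UN_I[of "map w [0..<n]"]) auto
  qed (use x_simps in auto)
  then have "emeasure ?W {w. w n = u \<and> w (Suc n) = v} =
      (\<integral>\<^sup>+xs. emeasure ?W {w. \<forall>i\<le>Suc n. w i = x xs i} \<partial>count_space ?L)"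
    using cyl disj by (simp add: emeasure_UN_countable)
  also have "\<dots> = (\<integral>\<^sup>+xs. emeasure ?W {w. \<forall>i\<le>n. w i = x xs i}
      * ennreal (pmf (step \<beta> T u) v) \<partial>count_space ?L)"
    by (intro nn_integral_cong) (simp add: walk_law_cylinder x_simps)
  also have "\<dots> = (\<integral>\<^sup>+xs. emeasure ?W {w. \<forall>i\<le>n. w i = x xs i} \<partial>count_space ?L)
      * ennreal (pmf (step \<beta> T u) v)"
    by (simp add: nn_integral_multc)
  also have "(\<integral>\<^sup>+xs. emeasure ?W {w. \<forall>i\<le>n. w i = x xs i} \<partial>count_space ?L) =
      emeasure ?W (\<Union>xs\<in>?L. {w. \<forall>i\<le>n. w i = x xs i})"
    using cyl disj by (simp add: emeasure_UN_countable)
  also have "(\<Union>xs\<in>?L. {w. \<forall>i\<le>n. w i = x xs i}) = {w. w n = u}"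
  proof (intro equalityI subsetI)
    fix w assume "w \<in> {w. w n = u}"
    then show "w \<in> (\<Union>xs\<in>?L. {w. \<forall>i\<le>n. w i = x xs i})"
      using ext[of w] by (intro UN_I[of "map w [0..<n]"]) auto
  qed (use x_simps in auto)
  finally show ?thesis .
qed

lemma emeasure_walk_position:
  "emeasure (walk_law \<beta> T) {w. w n \<in> A} = emeasure (position \<beta> T n) A"
proof -
  let ?W = "walk_law \<beta> T"
  have single: "emeasure ?W {w. w n = v} = ennreal (pmf (position \<beta> T n) v)" for v
  proof (induction n arbitrary: v)
    case 0
    have "emeasure ?W {w. w 0 = v} = emeasure ?W {w. \<forall>i\<le>0. w i = v}" by simp
    also have "\<dots> = ennreal (pmf (position \<beta> T 0) v)"
      by (subst walk_law_cylinder) (auto simp: indicator_def)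
    finally show ?case .
  next
    case (Suc n)
    have "{w. w (Suc n) = v} = (\<Union>u. {w. w n = u \<and> w (Suc n) = v})" by auto
    then have "emeasure ?W {w. w (Suc n) = v} =
        (\<integral>\<^sup>+u. emeasure ?W {w. w n = u \<and> w (Suc n) = v} \<partial>count_space UNIV)"
      by (simp only:) (intro emeasure_UN_countable, auto simp: disjoint_family_on_def intro!: sets_walk_Collect)
    also have "\<dots> = (\<integral>\<^sup>+u. ennreal (pmf (step \<beta> T u) v) \<partial>position \<beta> T n)"
      by (simp add: walk_two_positions Suc nn_integral_measure_pmf)
    also have "\<dots> = ennreal (pmf (position \<beta> T (Suc n)) v)"
      by (simp add: ennreal_pmf_bind)
    finally show ?case .
  qed
  have "distr ?W (count_space UNIV) (\<lambda>w. w n) = measure_pmf (position \<beta> T n)"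
    by (rule measure_eqI_countable[where A = UNIV])
       (auto simp: emeasure_distr emeasure_pmf_single single vimage_def)
  then have "emeasure (position \<beta> T n) A = emeasure (distr ?W (count_space UNIV) (\<lambda>w. w n)) A"
    by simp
  then show ?thesis by (simp add: emeasure_distr vimage_def)
qed

lemma pmf_step_None: "pmf (step \<beta> T None) v = (if v = None then 1 else 0)"
proof -
  have total: "(\<integral>\<^sup>+x. ennreal (pmf q x) \<partial>count_space UNIV) = 1" for q :: "vertex pmf"
    using measure_pmf.emeasure_space_1[of q] by (simp add: nn_integral_pmf)
  have "trans_prob \<beta> T None = pmf (return_pmf None)"
    by (auto simp: trans_prob_def fun_eq_iff)
  then have "pmf (step \<beta> T None) v = pmf (return_pmf None) v"
    using total by (simp only: step_def) (rule pmf_embed_pmf, simp_all only: pmf_nonneg)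
  then show ?thesis by (cases v) simp_all
qed

lemma AE_walk_absorbed:
  "AE w in walk_law \<beta> T. \<forall>n. w n = None \<longrightarrow> w (Suc n) = None"
proof -
  have "AE w in walk_law \<beta> T. \<forall>v. \<not> (w n = None \<and> w (Suc n) = Some v)" for n
  proof (subst AE_all_countable, rule allI)
    fix v
    have "emeasure (walk_law \<beta> T) {w. w n = None \<and> w (Suc n) = Some v} = 0"
      by (simp add: walk_two_positions pmf_step_None)
    moreover have "{w. w n = None \<and> w (Suc n) = Some v} \<in> sets (walk_law \<beta> T)"
      by (rule sets_walk_Collect) measurable
    ultimately show "AE w in walk_law \<beta> T. \<not> (w n = None \<and> w (Suc n) = Some v)"
      by (intro AE_I[where N = "{w. w n = None \<and> w (Suc n) = Some v}"]) auto
  qed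
  then have "AE w in walk_law \<beta> T. \<forall>n v. \<not> (w n = None \<and> w (Suc n) = Some v)"
    by (subst AE_all_countable) simp
  then show ?thesis by eventually_elim (metis not_None_eq)
qed

text \<open>
  If the walk never leaves the absorbing vertex, the time it spends elsewhere is at most any time at
  which it has been absorbed.
\<close>

lemma hit_time_ge_occupation:
  assumes "\<forall>n. w n = None \<longrightarrow> w (Suc n) = None"
  shows "(\<Sum>n. indicator {w. w n \<noteq> None} w) \<le> hit_time w"
  unfolding hit_time_def
proof (rule INF_greatest)
  fix m assume "m \<in> {n. w n = None}"
  then have m: "w m = None" by simp
  have "w n = None" if "n \<ge> m" for n
    using that by (induction n rule: dec_induct) (use assms m in auto)
  then have "(\<Sum>n. indicator {w. w n \<noteq> None} w :: ennreal) = (\<Sum>n<m. indicator {w. w n \<noteq> None} w)"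
    by (intro suminf_finite) (auto simp: not_less)
  also have "\<dots> \<le> (\<Sum>n<m. 1)"
    by (intro sum_mono) (auto simp: indicator_def)
  finally show "(\<Sum>n. indicator {w. w n \<noteq> None} w) \<le> (of_nat m :: ennreal)" by simp
qed

lemma walk_expectation_hit_time_ge:
  "(\<Sum>n. emeasure (position \<beta> T n) (- {None})) \<le> walk_expectation \<beta> T hit_time"
proof -
  let ?W = "walk_law \<beta> T"
  have meas: "{w. w n \<noteq> None} \<in> sets ?W" for n
    by (rule sets_walk_Collect) measurable
  have "(\<Sum>n. emeasure (position \<beta> T n) (- {None})) = (\<Sum>n. \<integral>\<^sup>+w. indicator {w. w n \<noteq> None} w \<partial>?W)"
    using emeasure_walk_position[of \<beta> T _ "- {None}"] meas by simp
  also have "\<dots> = (\<integral>\<^sup>+w. (\<Sum>n. indicator {w. w n \<noteq> None} w) \<partial>?W)"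
    using meas by (intro nn_integral_suminf[symmetric]) auto
  also have "\<dots> \<le> (\<integral>\<^sup>+w. hit_time w \<partial>?W)"
    by (rule nn_integral_mono_AE, rule AE_mp[OF AE_walk_absorbed])
       (rule AE_I2, blast intro: hit_time_ge_occupation)
  finally show ?thesis by (simp add: walk_expectation_def)
qed

lemma borel_measurable_hit_time: "hit_time \<in> borel_measurable (walk_law \<beta> T)"
proof -
  have "hit_time w = (INF n. if w n = None then of_nat n else top)" for w
    unfolding hit_time_def
  proof (rule antisym)
    show "(INF n. if w n = None then of_nat n else top) \<le> (INF n\<in>{n. w n = None}. of_nat n :: ennreal)"
    proof (rule INF_greatest)
      fix m assume "m \<in> {n. w n = None}"
      then show "(INF n. if w n = None then of_nat n else top) \<le> (of_nat m :: ennreal)"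
        by (intro INF_lower2[of m]) auto
    qed
  qed (rule INF_greatest, simp add: INF_lower)
  then have "hit_time = (\<lambda>w. INF n. if w n = None then of_nat n else top)" by auto
  then show ?thesis by (rule ssubst) measurable
qed

lemma walk_expectation_square_le:
  "(walk_expectation \<beta> T hit_time)\<^sup>2 \<le> walk_expectation \<beta> T (\<lambda>w. (hit_time w)\<^sup>2)"
proof -
  interpret prob_space "walk_law \<beta> T" by (rule prob_space_walk_law)
  have "emeasure (walk_law \<beta> T) UNIV = 1" using emeasure_space_1 by simp
  then show ?thesis
    using Cauchy_Schwarz_nn_integral[OF borel_measurable_hit_time borel_measurable_const, of \<beta> T 1]
    by (simp add: walk_expectation_def)
qed


section \<open>Visits to a vertex and flow through the edge above it\<close>

definition subtree :: "nat list \<Rightarrow> vertex set" where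
  "subtree x = {Some (x @ u) |u. True}"

definition parent :: "nat list \<Rightarrow> vertex" where
  "parent x = (if x = [] then None else Some (butlast x))"

text \<open>The mean number of visits to \<open>v\<close>, the Green function of the walk started from \<open>\<rho>\<close>.\<close>

definition green :: "real \<Rightarrow> tree \<Rightarrow> vertex \<Rightarrow> ennreal" where
  "green \<beta> T v = (\<Sum>n. ennreal (pmf (position \<beta> T n) v))"

text \<open>
  The conductance of the edge from \<open>x\<close> to its parent in the electrical network whose random walk is
  \<open>W\<close>. At \<open>\<rho>\<close> it is \<open>\<beta> + 1\<close>, since \<open>\<rho>\<close> moves to the absorbing vertex with weight \<open>\<beta> + 1\<close> against
  weight \<open>\<beta>\<close> for each child.
\<close>

definition up_conductance :: "real \<Rightarrow> nat list \<Rightarrow> real" where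
  "up_conductance \<beta> x = (if x = [] then \<beta> + 1 else \<beta> ^ length x)"

context
  fixes \<beta> :: real and T :: tree
  assumes beta_pos: "\<beta> > 0" and finite_children: "\<And>x. finite (children T x)"
begin

lemma pmf_step_eq: "pmf (step \<beta> T v) w = trans_prob \<beta> T v w"
  using beta_pos finite_children by (rule pmf_step)

text \<open>The only way out of a subtree leads through the edge above its root.\<close>

lemma subtree_step:
  assumes "y \<in> subtree x"
  shows "set_pmf (step \<beta> T y) \<subseteq> (if y = Some x then insert (parent x) (subtree x) else subtree x)"
proof
  fix v assume "v \<in> set_pmf (step \<beta> T y)"
  then have v: "trans_prob \<beta> T y v \<noteq> 0" by (simp add: set_pmf_iff pmf_step_eq)
  from assms obtain u where y: "y = Some (x @ u)" by (auto simp: subtree_def)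
  from v y have "v = parent (x @ u) \<or> (\<exists>i. v = Some (x @ u @ [i]))"
    by (auto simp: trans_prob_def Let_def parent_def children_def split: if_splits option.splits)
  moreover have "parent (x @ u) = Some (x @ butlast u)" if "u \<noteq> []"
    using that by (simp add: parent_def butlast_append)
  ultimately show "v \<in> (if y = Some x then insert (parent x) (subtree x) else subtree x)"
    using y by (cases "u = []") (auto simp: subtree_def)
qed

lemma parent_notin_subtree: "parent x \<notin> subtree x"
proof
  assume "parent x \<in> subtree x"
  then obtain u where "x \<noteq> []" "butlast x = x @ u"
    by (auto simp: parent_def subtree_def split: if_splits)
  then have "length (butlast x) = length (x @ u)" by simp
  with \<open>x \<noteq> []\<close> show False by (cases "length x") auto
qed

text \<open>
  Conservation of mass in one step from \<open>y\<close>: the subtree loses at most what moves up from \<open>x\<close>, and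
  gains at least what moves down from the parent.
\<close>

lemma subtree_crossing:
  "indicator (subtree x) y + ennreal (pmf (step \<beta> T (parent x)) (Some x)) * indicator {parent x} y
    \<le> emeasure (step \<beta> T y) (subtree x)
      + ennreal (pmf (step \<beta> T (Some x)) (parent x)) * indicator {Some x} y"
proof -
  have x_in: "Some x \<in> subtree x" by (auto simp: subtree_def)
  consider "y = parent x" | "y = Some x" | "y \<in> subtree x" "y \<noteq> Some x"
    | "y \<notin> subtree x" "y \<noteq> parent x" by blast
  then show ?thesis
  proof cases
    case 1
    have "ennreal (pmf (step \<beta> T (parent x)) (Some x)) = emeasure (step \<beta> T (parent x)) {Some x}"
      by (simp add: emeasure_pmf_single)
    also have "\<dots> \<le> emeasure (step \<beta> T (parent x)) (subtree x)"
      using x_in by (intro emeasure_mono) auto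
    finally show ?thesis
      using 1 parent_notin_subtree by (auto simp: add_increasing2)
  next
    case 2
    have "1 = emeasure (step \<beta> T (Some x)) (insert (parent x) (subtree x))"
      using subtree_step[OF x_in]
      by (intro measure_pmf.emeasure_eq_1_AE[symmetric]) (auto simp: AE_measure_pmf_iff)
    also have "\<dots> \<le> emeasure (step \<beta> T (Some x)) {parent x} + emeasure (step \<beta> T (Some x)) (subtree x)"
      using emeasure_subadditive[of "{parent x}" "step \<beta> T (Some x)" "subtree x"] by simp
    finally have "1 \<le> emeasure (step \<beta> T (Some x)) {parent x} + emeasure (step \<beta> T (Some x)) (subtree x)" .
    moreover have "parent x \<noteq> Some x" using x_in parent_notin_subtree[of x] by auto
    ultimately show ?thesis
      using 2 x_in by (simp add: emeasure_pmf_single add.commute)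
  next
    case 3
    have "emeasure (step \<beta> T y) (subtree x) = 1"
      using subtree_step[OF 3(1)] 3
      by (intro measure_pmf.emeasure_eq_1_AE) (auto simp: AE_measure_pmf_iff)
    moreover have "y \<noteq> parent x" using 3 parent_notin_subtree[of x] by auto
    ultimately show ?thesis using 3 by simp
  next
    case 4
    then show ?thesis using x_in by auto
  qed
qed

lemma subtree_flux:
  "emeasure (position \<beta> T n) (subtree x)
      + ennreal (pmf (step \<beta> T (parent x)) (Some x)) * ennreal (pmf (position \<beta> T n) (parent x))
    \<le> emeasure (position \<beta> T (Suc n)) (subtree x)
      + ennreal (pmf (step \<beta> T (Some x)) (parent x)) * ennreal (pmf (position \<beta> T n) (Some x))"
proof -
  let ?p = "ennreal (pmf (step \<beta> T (parent x)) (Some x))"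
  let ?q = "ennreal (pmf (step \<beta> T (Some x)) (parent x))"
  have "(\<integral>\<^sup>+y. indicator (subtree x) y + ?p * indicator {parent x} y \<partial>position \<beta> T n)
      \<le> (\<integral>\<^sup>+y. emeasure (step \<beta> T y) (subtree x) + ?q * indicator {Some x} y \<partial>position \<beta> T n)"
    by (intro nn_integral_mono subtree_crossing)
  then show ?thesis
    by (simp add: nn_integral_add nn_integral_cmult emeasure_pmf_single)
qed

lemma subtree_flux_sum:
  "indicator (subtree x) (Some []) + (\<Sum>n<N. ennreal (pmf (step \<beta> T (parent x)) (Some x))
        * ennreal (pmf (position \<beta> T n) (parent x)))
    \<le> emeasure (position \<beta> T N) (subtree x)
      + (\<Sum>n<N. ennreal (pmf (step \<beta> T (Some x)) (parent x)) * ennreal (pmf (position \<beta> T n) (Some x)))"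
proof (induction N)
  case 0
  then show ?case by simp
next
  case (Suc N)
  let ?f = "\<lambda>n. ennreal (pmf (step \<beta> T (parent x)) (Some x)) * ennreal (pmf (position \<beta> T n) (parent x))"
  let ?g = "\<lambda>n. ennreal (pmf (step \<beta> T (Some x)) (parent x)) * ennreal (pmf (position \<beta> T n) (Some x))"
  let ?e = "\<lambda>n. emeasure (position \<beta> T n) (subtree x)"
  have "indicator (subtree x) (Some []) + (\<Sum>n<Suc N. ?f n)
      = indicator (subtree x) (Some []) + (\<Sum>n<N. ?f n) + ?f N"
    by (simp only: sum.lessThan_Suc add.assoc)
  also have "\<dots> \<le> ?e N + (\<Sum>n<N. ?g n) + ?f N"
    by (rule add_right_mono[OF Suc])
  also have "\<dots> = ?e N + ?f N + (\<Sum>n<N. ?g n)" by (simp only: ac_simps)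
  also have "\<dots> \<le> ?e (Suc N) + ?g N + (\<Sum>n<N. ?g n)"
    by (rule add_right_mono[OF subtree_flux])
  also have "\<dots> = ?e (Suc N) + (\<Sum>n<Suc N. ?g n)"
    by (simp only: sum.lessThan_Suc ac_simps)
  finally show ?case .
qed

text \<open>
  By time \<open>N\<close> the moves down and up the edge above \<open>x\<close> differ in mean by the probability of being in
  the subtree at that time, up to the indicator for a walk that starts inside. When the mean time
  before absorption is finite, that probability tends to 0.
\<close>

lemma green_balance:
  assumes "(\<Sum>n. emeasure (position \<beta> T n) (- {None})) \<noteq> \<infinity>"
  shows "indicator (subtree x) (Some [])
      + ennreal (pmf (step \<beta> T (parent x)) (Some x)) * green \<beta> T (parent x)
    \<le> ennreal (pmf (step \<beta> T (Some x)) (parent x)) * green \<beta> T (Some x)"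
proof -
  define e where "e n = emeasure (position \<beta> T n) (- {None})" for n
  have "e \<longlonglongrightarrow> 0"
  proof -
    have fin: "e n < \<top>" for n by (simp add: e_def measure_pmf.emeasure_eq_measure)
    have "summable (\<lambda>n. enn2real (e n))"
      using assms fin unfolding e_def[symmetric] infinity_ennreal_def
      by (intro summable_suminf_not_top) auto
    then have "(\<lambda>n. ennreal (enn2real (e n))) \<longlonglongrightarrow> ennreal 0"
      by (intro tendsto_ennrealI summable_LIMSEQ_zero)
    then show ?thesis using fin by simp
  qed
  have "subtree x \<subseteq> - {None}" by (auto simp: subtree_def)
  then have le: "emeasure (position \<beta> T N) (subtree x) \<le> e N" for N
    unfolding e_def by (intro emeasure_mono) auto
  let ?f = "\<lambda>n. ennreal (pmf (step \<beta> T (parent x)) (Some x)) * ennreal (pmf (position \<beta> T n) (parent x))"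
  let ?g = "\<lambda>n. ennreal (pmf (step \<beta> T (Some x)) (parent x)) * ennreal (pmf (position \<beta> T n) (Some x))"
  have "indicator (subtree x) (Some []) + (\<Sum>n. ?f n) \<le> 0 + (\<Sum>n. ?g n)"
  proof (rule LIMSEQ_le)
    show "(\<lambda>N. indicator (subtree x) (Some []) + (\<Sum>n<N. ?f n)) \<longlonglongrightarrow>
        indicator (subtree x) (Some []) + (\<Sum>n. ?f n)"
      by (intro tendsto_add tendsto_const summable_LIMSEQ) simp
    show "(\<lambda>N. e N + (\<Sum>n<N. ?g n)) \<longlonglongrightarrow> 0 + (\<Sum>n. ?g n)"
      using \<open>e \<longlonglongrightarrow> 0\<close> by (intro tendsto_add summable_LIMSEQ) simp_all
    show "\<exists>N. \<forall>n\<ge>N. indicator (subtree x) (Some []) + (\<Sum>k<n. ?f k) \<le> e n + (\<Sum>k<n. ?g k)"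
      using subtree_flux_sum[of x] le by (blast intro: order_trans add_right_mono)
  qed
  then show ?thesis by (simp add: green_def)
qed

text \<open>
  Both moves leave \<open>x\<close>, so their probabilities have the same denominator and are in the ratio of the
  conductances of the two edges.
\<close>

lemma pmf_step_down:
  assumes "x @ [i] \<in> T"
  shows "pmf (step \<beta> T (Some x)) (Some (x @ [i])) * up_conductance \<beta> x
    = up_conductance \<beta> (x @ [i]) * pmf (step \<beta> T (Some x)) (parent x)"
proof -
  have child: "x @ [i] \<in> children T x" using assms by (auto simp: children_def)
  have bl: "butlast x \<notin> children T x"
  proof
    assume "butlast x \<in> children T x"
    then obtain j where "butlast x = x @ [j]" by (auto simp: children_def)
    then have "length (butlast x) = length (x @ [j])" by simp
    then show False by simp
  qed
  show ?thesis
    using child bl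
    by (auto simp: pmf_step_eq trans_prob_def Let_def parent_def up_conductance_def)
qed

text \<open>
  The right-hand side is the mean number of moves from \<open>x\<close> to its parent. It is at least 1 at the
  root, where the walk leaves for good, and \<open>green_balance\<close> with \<open>pmf_step_down\<close> multiplies it by
  the ratio of consecutive conductances at each step down a branch.
\<close>

lemma green_lower_bound:
  assumes fin: "(\<Sum>n. emeasure (position \<beta> T n) (- {None})) \<noteq> \<infinity>"
    and prefix_closed: "\<And>x i. x @ [i] \<in> T \<Longrightarrow> x \<in> T"
    and "x \<in> T"
  shows "ennreal (up_conductance \<beta> x / (\<beta> + 1))
    \<le> ennreal (pmf (step \<beta> T (Some x)) (parent x)) * green \<beta> T (Some x)"
  using \<open>x \<in> T\<close>
proof (induction x rule: rev_induct)
  case Nil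
  have "ennreal (up_conductance \<beta> [] / (\<beta> + 1)) = indicator (subtree []) (Some [])"
    using beta_pos by (simp add: up_conductance_def subtree_def)
  also have "\<dots> \<le> ennreal (pmf (step \<beta> T (Some [])) (parent [])) * green \<beta> T (Some [])"
    by (rule order_trans[OF _ green_balance[OF fin]]) simp
  finally show ?case .
next
  case (snoc i x)
  let ?p = "pmf (step \<beta> T (Some x)) (Some (x @ [i]))" and ?q = "pmf (step \<beta> T (Some x)) (parent x)"
  let ?c = "up_conductance \<beta> x" and ?c' = "up_conductance \<beta> (x @ [i])"
  have pos: "?c > 0" "?c' > 0" using beta_pos by (auto simp: up_conductance_def)
  have p: "?p = ?c' / ?c * ?q"
    using pmf_step_down[OF snoc.prems] pos by (simp add: field_simps)
  have "ennreal (?c' / (\<beta> + 1)) = ennreal (?c' / ?c) * ennreal (?c / (\<beta> + 1))"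
    using pos beta_pos by (subst ennreal_mult[symmetric]) auto
  also have "\<dots> \<le> ennreal (?c' / ?c) * (ennreal ?q * green \<beta> T (Some x))"
    using snoc.IH prefix_closed[OF snoc.prems] by (intro mult_left_mono) auto
  also have "ennreal (?c' / ?c) * (ennreal ?q * green \<beta> T (Some x)) = ennreal ?p * green \<beta> T (Some x)"
    unfolding p using pos by (subst ennreal_mult) (auto simp: mult.assoc)
  also have "\<dots> \<le> ennreal (pmf (step \<beta> T (Some (x @ [i]))) (parent (x @ [i]))) * green \<beta> T (Some (x @ [i]))"
    by (rule order_trans[OF _ green_balance[OF fin]]) (simp add: parent_def)
  finally show ?case .
qed

lemma walk_expectation_hit_time_ge_tree_sum:
  assumes prefix_closed: "\<And>x i. x @ [i] \<in> T \<Longrightarrow> x \<in> T"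
  shows "(\<integral>\<^sup>+x. ennreal (\<beta> ^ length x / (\<beta> + 1)) \<partial>count_space T) \<le> walk_expectation \<beta> T hit_time"
proof (cases "(\<Sum>n. emeasure (position \<beta> T n) (- {None})) = \<infinity>")
  case True
  then show ?thesis using walk_expectation_hit_time_ge[of \<beta> T] by (simp add: top_unique)
next
  case False
  have "ennreal (\<beta> ^ length x / (\<beta> + 1)) \<le> green \<beta> T (Some x)" if "x \<in> T" for x
  proof -
    have "ennreal (\<beta> ^ length x / (\<beta> + 1)) \<le> ennreal (up_conductance \<beta> x / (\<beta> + 1))"
      using beta_pos by (intro ennreal_leI divide_right_mono) (auto simp: up_conductance_def)
    also have "\<dots> \<le> ennreal (pmf (step \<beta> T (Some x)) (parent x)) * green \<beta> T (Some x)"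
      by (rule green_lower_bound[OF False prefix_closed that])
    also have "\<dots> \<le> 1 * green \<beta> T (Some x)"
      by (intro mult_right_mono) (auto simp: pmf_le_1)
    finally show ?thesis by simp
  qed
  then have "(\<integral>\<^sup>+x. ennreal (\<beta> ^ length x / (\<beta> + 1)) \<partial>count_space T)
      \<le> (\<integral>\<^sup>+x. green \<beta> T (Some x) \<partial>count_space T)"
    by (intro nn_integral_mono) simp
  also have "\<dots> = (\<Sum>n. \<integral>\<^sup>+x. ennreal (pmf (position \<beta> T n) (Some x)) \<partial>count_space T)"
    unfolding green_def by (intro nn_integral_suminf) simp
  also have "\<dots> = (\<Sum>n. \<integral>\<^sup>+v. ennreal (pmf (position \<beta> T n) v) \<partial>count_space (Some ` T))"
    by (intro suminf_cong nn_integral_bij_count_space[where g = Some and f = "\<lambda>v. ennreal (pmf (position \<beta> T _) v)"]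
        inj_on_imp_bij_betw) auto
  also have "\<dots> \<le> (\<Sum>n. emeasure (position \<beta> T n) (- {None}))"
    unfolding nn_integral_pmf by (intro suminf_le emeasure_mono) auto
  also have "\<dots> \<le> walk_expectation \<beta> T hit_time" by (rule walk_expectation_hit_time_ge)
  finally show ?thesis .
qed

end


section \<open>The vertices of the random tree\<close>

lemma Cons_in_bar_tree_iff:
  "i # u \<in> bar_tree (k, N) \<longleftrightarrow> i < k - 1 \<and> u \<in> offspring_tree (N i)"
  by (auto simp: bar_tree_def)

lemma snoc_in_offspring_tree_iff:
  "u @ [i] \<in> offspring_tree N \<longleftrightarrow> u \<in> offspring_tree N \<and> i < N u"
  by (auto intro: offspring_tree.child elim: offspring_tree.cases)

lemma bar_tree_prefix_closed: "x @ [i] \<in> bar_tree s \<Longrightarrow> x \<in> bar_tree s"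
  by (cases s; cases x) (auto simp: Cons_in_bar_tree_iff snoc_in_offspring_tree_iff, simp add: bar_tree_def)

lemma walk_expectation_bar_tree_ge:
  assumes "\<beta> > 0"
  shows "(\<integral>\<^sup>+x. ennreal (\<beta> ^ length x / (\<beta> + 1)) \<partial>count_space (bar_tree s))
    \<le> walk_expectation \<beta> (bar_tree s) hit_time"
  using assms finite_children_bar_tree bar_tree_prefix_closed
  by (rule walk_expectation_hit_time_ge_tree_sum)

lemma offspring_tree_iff:
  "u \<in> offspring_tree N \<longleftrightarrow> (\<forall>j<length u. u ! j < N (take j u))"
proof (induction u rule: rev_induct)
  case Nil
  show ?case by (simp add: offspring_tree.root)
next
  case (snoc i u)
  then show ?case
    by (auto simp: snoc_in_offspring_tree_iff nth_append less_Suc_eq)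
qed

lemma prob_space_gw_space: "prob_space (gw_space p)"
  unfolding gw_space_def by (intro prob_space_PiM) (simp add: measure_pmf.prob_space_axioms)

lemma sets_offspring_tree: "{N. u \<in> offspring_tree N} \<in> sets (gw_space p)"
proof -
  have "(\<lambda>N. N v) \<in> measurable (gw_space p) (count_space UNIV)" for v
    using measurable_component_singleton[of v UNIV "\<lambda>_. measure_pmf p"]
    by (simp add: gw_space_def)
  from measurable_sets[OF this]
  have single: "{N \<in> space (gw_space p). N v \<in> B} \<in> sets (gw_space p)" for v B
    by (simp add: vimage_def Int_def conj_commute)
  have "{N \<in> space (gw_space p). \<forall>j\<in>{..<length u}. N (take j u) \<in> {u ! j<..}} \<in> sets (gw_space p)"
    by (intro sets.sets_Collect_finite_All single) simp
  then show ?thesis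
    by (simp add: offspring_tree_iff gw_space_def space_PiM Ball_def)
qed

text \<open>
  The word \<open>u\<close> is a vertex exactly when each proper prefix has enough children, and the offspring
  numbers of distinct prefixes are independent.
\<close>

lemma emeasure_offspring_tree:
  "emeasure (gw_space p) {N. u \<in> offspring_tree N} = (\<Prod>i\<leftarrow>u. emeasure p {i<..})"
proof -
  interpret product_prob_space "\<lambda>_ :: nat list. measure_pmf p" UNIV
    by unfold_locales
  let ?J = "(\<lambda>j. take j u) ` {..<length u}"
  have inj: "inj_on (\<lambda>j. take j u) {..<length u}"
    by (auto simp: inj_on_def) (metis length_take min.absorb2 less_imp_le)
  have "{N. u \<in> offspring_tree N} =
      {N \<in> space (gw_space p). \<forall>v\<in>?J. N v \<in> {u ! length v<..}}"
    by (auto simp: offspring_tree_iff gw_space_def space_PiM)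
  then have "emeasure (gw_space p) {N. u \<in> offspring_tree N} = (\<Prod>v\<in>?J. emeasure p {u ! length v<..})"
    unfolding gw_space_def by (simp only:) (rule emeasure_PiM_Collect, auto)
  also have "\<dots> = (\<Prod>j<length u. emeasure p {u ! j<..})"
    by (simp add: prod.reindex[OF inj])
  also have "\<dots> = (\<Prod>i\<leftarrow>u. emeasure p {i<..})"
    by (simp add: prod.list_conv_set_nth atLeast0LessThan)
  finally show ?thesis .
qed

lemma nn_integral_count_space_list:
  fixes F :: "'a list \<Rightarrow> ennreal"
  shows "(\<integral>\<^sup>+u. F u \<partial>count_space UNIV) =
    F [] + (\<integral>\<^sup>+i. \<integral>\<^sup>+u. F (i # u) \<partial>count_space UNIV \<partial>count_space UNIV)"
proof -
  have "(\<integral>\<^sup>+u. F u \<partial>count_space UNIV) =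
      (\<integral>\<^sup>+u. F [] * indicator {[]} u + F u * indicator (- {[]}) u \<partial>count_space UNIV)"
    by (intro nn_integral_cong) (auto simp: indicator_def)
  also have "\<dots> = F [] + (\<integral>\<^sup>+u. F u \<partial>count_space (- {[]}))"
    by (subst nn_integral_add) (auto simp: nn_integral_cmult nn_integral_count_space_indicator)
  also have "(\<integral>\<^sup>+u. F u \<partial>count_space (- {[]})) =
      (\<integral>\<^sup>+z. F (fst z # snd z) \<partial>count_space UNIV)"
  proof (rule nn_integral_bij_count_space[symmetric])
    show "bij_betw (\<lambda>z. fst z # snd z) UNIV (- {[] :: 'a list})"
      by (rule bij_betwI[where g = "\<lambda>u. (hd u, tl u)"]) auto
  qed
  also have "\<dots> = (\<integral>\<^sup>+i. \<integral>\<^sup>+u. F (i # u) \<partial>count_space UNIV \<partial>count_space UNIV)"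
    by (subst nn_integral_fst_count_space[symmetric]) simp
  finally show ?thesis .
qed

text \<open>
  The sum over words of length \<open>n\<close> is the \<open>n\<close>-th power of the total weight of the letters, so this is
  a divergent geometric series. Splitting off the first letter shows that the sum \<open>M\<close> satisfies
  \<open>M \<ge> 1 + M\<close>, which avoids grouping the words by length.
\<close>

lemma sum_product_weights_infinite:
  fixes t :: "'a \<Rightarrow> ennreal"
  assumes "(\<integral>\<^sup>+i. t i \<partial>count_space UNIV) \<ge> 1"
  shows "(\<integral>\<^sup>+u. (\<Prod>i\<leftarrow>u. t i) \<partial>count_space UNIV) = \<infinity>"
proof -
  let ?M = "\<integral>\<^sup>+u. (\<Prod>i\<leftarrow>u. t i) \<partial>count_space UNIV"
  have "?M = 1 + (\<integral>\<^sup>+i. t i * ?M \<partial>count_space UNIV)"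
    by (subst nn_integral_count_space_list) (simp add: nn_integral_cmult)
  also have "\<dots> = 1 + (\<integral>\<^sup>+i. t i \<partial>count_space UNIV) * ?M"
    by (simp add: nn_integral_multc)
  finally have "?M = 1 + (\<integral>\<^sup>+i. t i \<partial>count_space UNIV) * ?M" .
  moreover have "1 * ?M \<le> (\<integral>\<^sup>+i. t i \<partial>count_space UNIV) * ?M"
    by (rule mult_right_mono[OF assms]) simp
  ultimately have "1 + ?M \<le> ?M" by (metis add_left_mono mult_1)
  then show ?thesis
    by (cases ?M) (auto simp: ennreal_plus[symmetric] ennreal_1[symmetric] simp del: ennreal_plus ennreal_1)
qed

lemma sum_tail_eq_offspring_mean:
  assumes "integrable (measure_pmf p) real"
  shows "(\<integral>\<^sup>+i. emeasure p {i<..} \<partial>count_space UNIV) = ennreal (offspring_mean p)"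
proof -
  have "(\<integral>\<^sup>+i. emeasure p {i<..} \<partial>count_space UNIV) = (\<integral>\<^sup>+k. of_nat k \<partial>measure_pmf p)"
    by (subst nn_integral_nat_function) (auto simp: nn_integral_count_space_nat greaterThan_def)
  also have "\<dots> = (\<integral>\<^sup>+k. ennreal (real k) \<partial>measure_pmf p)"
    by (intro nn_integral_cong) (simp add: ennreal_of_nat_eq_real_of_nat)
  also have "\<dots> = ennreal (offspring_mean p)"
    using assms unfolding offspring_mean_def by (intro nn_integral_eq_integral) auto
  finally show ?thesis .
qed

lemma nn_integral_count_space_mono:
  assumes "A \<subseteq> B"
  shows "(\<integral>\<^sup>+x. f x \<partial>count_space A) \<le> (\<integral>\<^sup>+x. f x \<partial>count_space B)"
  using assms
  by (simp add: nn_integral_count_space_indicator)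
     (intro nn_integral_mono, auto simp: indicator_def)

lemma sum_squares_le_square_sum:
  fixes a :: "'a \<Rightarrow> ennreal"
  shows "(\<integral>\<^sup>+x. (a x)\<^sup>2 \<partial>count_space A) \<le> (\<integral>\<^sup>+x. a x \<partial>count_space A)\<^sup>2"
proof -
  have le: "a x \<le> (\<integral>\<^sup>+x. a x \<partial>count_space A)" if "x \<in> A" for x
    using nn_integral_ge_point[OF that] .
  have "(\<integral>\<^sup>+x. (a x)\<^sup>2 \<partial>count_space A) \<le> (\<integral>\<^sup>+x. a x * (\<integral>\<^sup>+x. a x \<partial>count_space A) \<partial>count_space A)"
    unfolding power2_eq_square by (intro nn_integral_mono mult_left_mono) (auto intro: le)
  also have "\<dots> = (\<integral>\<^sup>+x. a x \<partial>count_space A)\<^sup>2"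
    by (simp add: nn_integral_multc power2_eq_square)
  finally show ?thesis .
qed

lemma prob_space_attached_trees: "prob_space (PiM UNIV (\<lambda>_ :: nat. gw_space p))"
  by (intro prob_space_PiM prob_space_gw_space)

text \<open>The root has a child as soon as \<open>\<xi>\<^sup>* \<ge> 2\<close>, and \<open>\<xi>\<^sup>*\<close> is independent of the tree below that child.\<close>

lemma emeasure_bar_tree_space_first_subtree:
  "{(k, N). k \<ge> 2 \<and> u \<in> offspring_tree (N 0)} \<in> sets (bar_tree_space p)" (is "?A \<in> _")
  "emeasure (bar_tree_space p) {(k, N). k \<ge> 2 \<and> u \<in> offspring_tree (N 0)} =
    emeasure (size_biased p) {2..} * (\<Prod>i\<leftarrow>u. emeasure p {i<..})"
proof -
  let ?P = "PiM UNIV (\<lambda>_ :: nat. gw_space p)"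
  interpret P: prob_space ?P by (rule prob_space_attached_trees)
  interpret product_prob_space "\<lambda>_ :: nat. gw_space p" UNIV
    by (intro product_prob_space.intro product_prob_space_axioms.intro product_sigma_finite.intro
        prob_space_imp_sigma_finite prob_space_gw_space)
  have space: "space ?P = UNIV" by (simp add: space_PiM gw_space_def)
  have B_eq: "{N. u \<in> offspring_tree (N 0)} = {N \<in> space ?P. N 0 \<in> {N. u \<in> offspring_tree N}}"
    by (simp add: space)
  have B: "{N. u \<in> offspring_tree (N 0)} \<in> sets ?P"
    unfolding B_eq using sets_offspring_tree by measurable
  have A_eq: "?A = {2..} \<times> {N. u \<in> offspring_tree (N 0)}" by auto
  show "?A \<in> sets (bar_tree_space p)"
    unfolding A_eq bar_tree_space_def using B by (intro pair_measureI) auto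
  have "emeasure ?P {N. u \<in> offspring_tree (N 0)} = (\<Prod>i\<leftarrow>u. emeasure p {i<..})"
    unfolding B_eq
    by (subst emeasure_PiM_Collect_single) (auto simp: sets_offspring_tree emeasure_offspring_tree)
  then show "emeasure (bar_tree_space p) ?A =
    emeasure (size_biased p) {2..} * (\<Prod>i\<leftarrow>u. emeasure p {i<..})"
    unfolding A_eq bar_tree_space_def using B by (subst P.emeasure_pair_measure_Times) auto
qed

section \<open>Divergence of the second moment\<close>

lemma power_prod_list: "(\<Prod>i\<leftarrow>u. c * f i) = c ^ length u * (\<Prod>i\<leftarrow>u. f i)"
  for f :: "'a \<Rightarrow> 'b :: comm_monoid_mult"
  by (induction u) (auto simp: ac_simps)

text \<open>
  Only the diagonal terms of the squared sum are kept, and only for vertices below the first child of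
  the root. Their mean is, up to a constant, a sum over words whose letters \<open>i\<close> carry the weight
  \<open>\<beta>\<^sup>2 * P(\<xi> > i)\<close>, of total \<open>\<beta>\<^sup>2 \<mu>\<close>.
\<close>

lemma mean_hit_time_square_infinite_if_growth:
  assumes mean: "integrable (measure_pmf p) real" "0 < offspring_mean p"
    and two: "\<exists>k\<ge>2. pmf p k > 0"
    and "\<beta> > 0" and growth: "\<beta>\<^sup>2 * offspring_mean p \<ge> 1"
  shows "tree_expectation p (\<lambda>T. (walk_expectation \<beta> T hit_time)\<^sup>2) = \<infinity>"
proof -
  let ?S = "bar_tree_space p" and ?t = "\<lambda>i. emeasure p {i<..}"
  define A where "A u = {(k :: nat, N :: nat \<Rightarrow> nat list \<Rightarrow> nat). k \<ge> 2 \<and> u \<in> offspring_tree (N 0)}" for u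
  define a where "a x = ennreal (\<beta> ^ length x / (\<beta> + 1))" for x :: "nat list"
  have A [measurable]: "A u \<in> sets ?S" for u
    unfolding A_def by (rule emeasure_bar_tree_space_first_subtree)
  have pointwise: "(\<integral>\<^sup>+u. (a (0 # u))\<^sup>2 * indicator (A u) s \<partial>count_space UNIV)
      \<le> (walk_expectation \<beta> (bar_tree s) hit_time)\<^sup>2" for s
  proof -
    let ?U = "{u. s \<in> A u}"
    have "(\<integral>\<^sup>+u. (a (0 # u))\<^sup>2 * indicator (A u) s \<partial>count_space UNIV)
        = (\<integral>\<^sup>+u. (a (0 # u))\<^sup>2 \<partial>count_space ?U)"
      by (subst nn_integral_count_space_indicator) (auto intro!: nn_integral_cong simp: indicator_def)
    also have "\<dots> = (\<integral>\<^sup>+x. (a x)\<^sup>2 \<partial>count_space ((#) 0 ` ?U))"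
      by (intro nn_integral_bij_count_space[where g = "(#) 0" and f = "\<lambda>x. (a x)\<^sup>2"]
          inj_on_imp_bij_betw) auto
    also have "\<dots> \<le> (\<integral>\<^sup>+x. (a x)\<^sup>2 \<partial>count_space (bar_tree s))"
    proof -
      have "(#) 0 ` ?U \<subseteq> bar_tree s"
        by (cases s) (auto simp: A_def Cons_in_bar_tree_iff)
      then show ?thesis by (rule nn_integral_count_space_mono)
    qed
    also have "\<dots> \<le> (\<integral>\<^sup>+x. a x \<partial>count_space (bar_tree s))\<^sup>2"
      by (rule sum_squares_le_square_sum)
    also have "\<dots> \<le> (walk_expectation \<beta> (bar_tree s) hit_time)\<^sup>2"
      unfolding a_def by (intro power_mono walk_expectation_bar_tree_ge \<open>\<beta> > 0\<close>) simp
    finally show ?thesis .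
  qed
  have "pmf (size_biased p) k > 0" if "k \<ge> 2" "pmf p k > 0" for k
    using that mean by (simp add: pmf_size_biased)
  with two obtain k where "k \<ge> 2" "pmf (size_biased p) k > 0" by blast
  then have "0 < emeasure (size_biased p) {k}" by (simp add: emeasure_pmf_single)
  also have "\<dots> \<le> emeasure (size_biased p) {2..}"
    using \<open>k \<ge> 2\<close> by (intro emeasure_mono) auto
  finally have pos: "emeasure (size_biased p) {2..} \<noteq> 0" by simp
  have weight: "(a (0 # u))\<^sup>2 * (\<Prod>i\<leftarrow>u. ?t i) =
      ennreal ((\<beta> / (\<beta> + 1))\<^sup>2) * (\<Prod>i\<leftarrow>u. ennreal (\<beta>\<^sup>2) * ?t i)" for u
  proof -
    have "(a (0 # u))\<^sup>2 = ennreal ((\<beta> / (\<beta> + 1))\<^sup>2 * (\<beta>\<^sup>2) ^ length u)"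
      using \<open>\<beta> > 0\<close> unfolding a_def
      by (subst ennreal_power) (auto simp: power_mult_distrib power_divide power2_eq_square)
    also have "\<dots> = ennreal ((\<beta> / (\<beta> + 1))\<^sup>2) * ennreal (\<beta>\<^sup>2) ^ length u"
      by (simp add: ennreal_mult ennreal_power)
    finally show ?thesis by (simp add: power_prod_list mult.assoc)
  qed
  have "(\<integral>\<^sup>+i. ennreal (\<beta>\<^sup>2) * ?t i \<partial>count_space UNIV) = ennreal (\<beta>\<^sup>2 * offspring_mean p)"
    using mean by (simp add: nn_integral_cmult sum_tail_eq_offspring_mean ennreal_mult)
  then have infinite: "(\<integral>\<^sup>+u. (\<Prod>i\<leftarrow>u. ennreal (\<beta>\<^sup>2) * ?t i) \<partial>count_space UNIV) = \<infinity>"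
    using growth by (intro sum_product_weights_infinite) simp
  have "\<infinity> = emeasure (size_biased p) {2..} * (ennreal ((\<beta> / (\<beta> + 1))\<^sup>2)
      * (\<integral>\<^sup>+u. (\<Prod>i\<leftarrow>u. ennreal (\<beta>\<^sup>2) * ?t i) \<partial>count_space UNIV))"
    using pos \<open>\<beta> > 0\<close> by (simp add: infinite ennreal_mult_top)
  also have "\<dots> = (\<integral>\<^sup>+u. emeasure (size_biased p) {2..} * (ennreal ((\<beta> / (\<beta> + 1))\<^sup>2)
      * (\<Prod>i\<leftarrow>u. ennreal (\<beta>\<^sup>2) * ?t i)) \<partial>count_space UNIV)"
    by (simp add: nn_integral_cmult)
  also have "\<dots> = (\<integral>\<^sup>+u. (a (0 # u))\<^sup>2 * emeasure ?S (A u) \<partial>count_space UNIV)"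
    unfolding weight[symmetric] A_def emeasure_bar_tree_space_first_subtree(2) by (simp add: ac_simps)
  also have "\<dots> = (\<integral>\<^sup>+s. \<integral>\<^sup>+u. (a (0 # u))\<^sup>2 * indicator (A u) s \<partial>count_space UNIV \<partial>?S)"
    by (subst nn_integral_count_space_nn_integral) (auto simp: nn_integral_cmult)
  also have "\<dots> \<le> (\<integral>\<^sup>+s. (walk_expectation \<beta> (bar_tree s) hit_time)\<^sup>2 \<partial>?S)"
    by (intro nn_integral_mono pointwise)
  finally show ?thesis by (simp add: tree_expectation_def top_unique)
qed

lemma nn_integral_bar_tree_space_fst:
  "(\<integral>\<^sup>+s. f (fst s) \<partial>bar_tree_space p) = (\<integral>\<^sup>+k. f k \<partial>size_biased p)"
proof -
  interpret P: prob_space "PiM UNIV (\<lambda>_ :: nat. gw_space p)" by (rule prob_space_attached_trees)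
  have "(\<integral>\<^sup>+s. f (fst s) \<partial>bar_tree_space p) =
      (\<integral>\<^sup>+k. f k \<partial>distr (bar_tree_space p) (size_biased p) fst)"
    unfolding bar_tree_space_def by (subst nn_integral_distr) auto
  then show ?thesis
    unfolding bar_tree_space_def P.distr_pair_fst .
qed

lemma size_biased_second_moment_infinite:
  assumes mean: "integrable (measure_pmf p) real" "0 < offspring_mean p"
    and third: "(\<integral>\<^sup>+k. ennreal (real k ^ 3) \<partial>measure_pmf p) = \<infinity>"
  shows "(\<integral>\<^sup>+k. ennreal ((real (k - 1))\<^sup>2) \<partial>size_biased p) = \<infinity>"
proof -
  let ?I = "\<integral>\<^sup>+k. ennreal ((real (k - 1))\<^sup>2) \<partial>size_biased p"
  let ?c = "4 * offspring_mean p"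
  \<comment> \<open>For \<open>k \<ge> 2\<close> this follows from \<open>k \<le> 2 * (k - 1)\<close>; the summand 1 covers \<open>k \<le> 1\<close>.\<close>
  have cube: "real k ^ 3 \<le> 1 + 4 * real k * (real (k - 1))\<^sup>2" for k :: nat
  proof (cases "k \<le> 1")
    case True
    then show ?thesis by (cases k) auto
  next
    case False
    then have "real k \<le> 2 * real (k - 1)" by (simp add: of_nat_diff)
    then have "(real k)\<^sup>2 \<le> (2 * real (k - 1))\<^sup>2" by (intro power_mono) auto
    then have "real k * (real k)\<^sup>2 \<le> real k * (2 * real (k - 1))\<^sup>2" by (intro mult_left_mono) auto
    then show ?thesis by (simp add: power3_eq_cube power2_eq_square)
  qed
  have "\<infinity> = (\<integral>\<^sup>+k. ennreal (real k ^ 3) \<partial>measure_pmf p)" by (simp add: third)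
  also have "\<dots> \<le> (\<integral>\<^sup>+k. 1 + ennreal (4 * real k * (real (k - 1))\<^sup>2) \<partial>measure_pmf p)"
    using cube by (intro nn_integral_mono)
      (simp add: ennreal_plus[symmetric] ennreal_1[symmetric] ennreal_leI del: ennreal_plus ennreal_1)
  also have "\<dots> = 1 + (\<integral>\<^sup>+k. ennreal (4 * real k * (real (k - 1))\<^sup>2) \<partial>measure_pmf p)"
    by (simp add: nn_integral_add)
  also have "(\<integral>\<^sup>+k. ennreal (4 * real k * (real (k - 1))\<^sup>2) \<partial>measure_pmf p) = ennreal ?c * ?I"
  proof -
    have "(\<integral>\<^sup>+k. ennreal (4 * real k * (real (k - 1))\<^sup>2) \<partial>measure_pmf p) =
        (\<integral>\<^sup>+k. ennreal ?c * (ennreal (pmf (size_biased p) k) * ennreal ((real (k - 1))\<^sup>2)) \<partial>count_space UNIV)"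
      unfolding nn_integral_measure_pmf using mean
      by (intro nn_integral_cong) (simp add: pmf_size_biased ennreal_mult'[symmetric])
    then show ?thesis by (simp add: nn_integral_cmult nn_integral_measure_pmf)
  qed
  finally have "1 + ennreal ?c * ?I = \<infinity>" by (simp add: top_unique)
  then show ?thesis by (simp add: ennreal_mult_eq_top_iff)
qed

text \<open>
  Each child of the root contributes \<open>\<beta> / (\<beta> + 1)\<close> to the lower bound, so the mean hitting time is at
  least a multiple of \<open>\<xi>\<^sup>* - 1\<close>.
\<close>

lemma mean_hit_time_square_infinite_if_third_moment:
  assumes mean: "integrable (measure_pmf p) real" "0 < offspring_mean p"
    and third: "(\<integral>\<^sup>+k. ennreal (real k ^ 3) \<partial>measure_pmf p) = \<infinity>"
    and "\<beta> > 0"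
  shows "tree_expectation p (\<lambda>T. (walk_expectation \<beta> T hit_time)\<^sup>2) = \<infinity>"
proof -
  let ?c = "\<beta> / (\<beta> + 1)"
  have pointwise: "ennreal (?c\<^sup>2) * ennreal ((real (fst s - 1))\<^sup>2)
      \<le> (walk_expectation \<beta> (bar_tree s) hit_time)\<^sup>2" for s
  proof -
    obtain k N where s: "s = (k, N)" by (cases s)
    let ?C = "(\<lambda>i. [i]) ` {..<k - 1}"
    have sub: "?C \<subseteq> bar_tree s"
      by (auto simp: s Cons_in_bar_tree_iff offspring_tree.root)
    have "ennreal (?c * real (k - 1)) = (\<Sum>x\<in>?C. ennreal (\<beta> ^ length x / (\<beta> + 1)))"
      using \<open>\<beta> > 0\<close> by (simp add: sum.reindex inj_on_def ennreal_of_nat_eq_real_of_nat ennreal_mult'[symmetric] mult.commute)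
    also have "\<dots> = (\<integral>\<^sup>+x. ennreal (\<beta> ^ length x / (\<beta> + 1)) \<partial>count_space ?C)"
      by (simp add: nn_integral_count_space_finite)
    also have "\<dots> \<le> (\<integral>\<^sup>+x. ennreal (\<beta> ^ length x / (\<beta> + 1)) \<partial>count_space (bar_tree s))"
      using sub by (rule nn_integral_count_space_mono)
    also have "\<dots> \<le> walk_expectation \<beta> (bar_tree s) hit_time"
      by (rule walk_expectation_bar_tree_ge[OF \<open>\<beta> > 0\<close>])
    finally have "(ennreal (?c * real (k - 1)))\<^sup>2 \<le> (walk_expectation \<beta> (bar_tree s) hit_time)\<^sup>2"
      by (rule power_mono) simp
    then show ?thesis
      using \<open>\<beta> > 0\<close> by (simp add: s ennreal_power ennreal_mult'[symmetric] power_mult_distrib power_divide)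
  qed
  have "\<infinity> = ennreal (?c\<^sup>2) * (\<integral>\<^sup>+k. ennreal ((real (k - 1))\<^sup>2) \<partial>size_biased p)"
    unfolding size_biased_second_moment_infinite[OF mean third]
    using \<open>\<beta> > 0\<close> by (simp add: ennreal_mult_top)
  also have "\<dots> = (\<integral>\<^sup>+s. ennreal (?c\<^sup>2) * ennreal ((real (fst s - 1))\<^sup>2) \<partial>bar_tree_space p)"
    by (subst nn_integral_bar_tree_space_fst) (simp add: nn_integral_cmult)
  also have "\<dots> \<le> (\<integral>\<^sup>+s. (walk_expectation \<beta> (bar_tree s) hit_time)\<^sup>2 \<partial>bar_tree_space p)"
    by (intro nn_integral_mono pointwise)
  finally show ?thesis by (simp add: tree_expectation_def top_unique)
qed

theorem lemma4p12:
  fixes p :: "nat pmf" and \<beta> :: real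
  assumes "integrable (measure_pmf p) real"
    and "0 < offspring_mean p" and "offspring_mean p < 1"
    and "integrable (measure_pmf p) (\<lambda>k. (real k - offspring_mean p)\<^sup>2)"
    and "\<exists>k\<ge>2. pmf p k > 0"
    and "\<beta> > 1"
    and "\<beta>\<^sup>2 * offspring_mean p \<ge> 1 \<or> (\<integral>\<^sup>+k. ennreal (real k ^ 3) \<partial>measure_pmf p) = \<infinity>"
  shows "annealed_expectation p \<beta> (\<lambda>w. (hit_time w)\<^sup>2)
           \<ge> tree_expectation p (\<lambda>T. (walk_expectation \<beta> T hit_time)\<^sup>2)
       \<and> tree_expectation p (\<lambda>T. (walk_expectation \<beta> T hit_time)\<^sup>2) = \<infinity>"
proof
  show "tree_expectation p (\<lambda>T. (walk_expectation \<beta> T hit_time)\<^sup>2)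
      \<le> annealed_expectation p \<beta> (\<lambda>w. (hit_time w)\<^sup>2)"
    unfolding annealed_expectation_def tree_expectation_def
    by (intro nn_integral_mono walk_expectation_square_le)
  have "\<beta> > 0" using \<open>\<beta> > 1\<close> by simp
  from assms(7) show "tree_expectation p (\<lambda>T. (walk_expectation \<beta> T hit_time)\<^sup>2) = \<infinity>"
  proof
    assume "\<beta>\<^sup>2 * offspring_mean p \<ge> 1"
    then show ?thesis
      using assms(1,2,5) \<open>\<beta> > 0\<close> by (intro mean_hit_time_square_infinite_if_growth)
  next
    assume "(\<integral>\<^sup>+k. ennreal (real k ^ 3) \<partial>measure_pmf p) = \<infinity>"
    then show ?thesis
      using assms(1,2) \<open>\<beta> > 0\<close> by (intro mean_hit_time_square_infinite_if_third_moment)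
  qed
qed

end
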